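(* A geodesic metric space $X$ equipped with a bounded geodesic combing is Morse dichotomous.
   Context: A geodesic combing assigns to every ordered pair $(x,y)\in X\times X$ a geodesic $q_{xy}$ from $x$ to $y$ (parametrized by arc length on $[0,d(x,y)]$ and extended to $\mathbb R$ by constant maps). It is bounded if there is $\kappa_0\ge0$ with $d(q_{xy_1}(t),q_{xy_2}(t))\le\kappa_0d(y_1,y_2)+\kappa_0$ for all $t\in\mathbb R$ and $x,y_1,y_2\in X$. A $(Q,q)$-quasi-geodesic ($Q\ge1,q\ge0$) is a map $\gamma:I\to X$, $I\subseteq\mathbb R$ an interval, with $\frac1Q|t_1-t_2|-q\le d(\gamma(t_1),\gamma(t_2))\le Q|t_1-t_2|+q$. Convention: quasi-geodesics are assumed improved, i.e. continuous and such that the length of $\gamma|_{[t,t']}$ is at most $k_1d(\gamma(t),\gamma(t'))+k_2$, where $q'=2(Q+q)$, $k_1=Q(Q+q)$, $k_2=(Qq'+3)(Q+q)$. A Morse gauge is a function $M:\mathbb R_{\ge1}\times\mathbb R_{\ge0}\to\mathbb R_{\ge0}$, non-decreasing in each variable and continuous in the second. A (quasi-)geodesic $\gamma$ is $M$-Morse if every $(Q,q)$-quasi-geodesic with endpoints $\gamma(s),\gamma(t)$ lies in the $M(Q,q)$-neighbourhood of $\gamma|_{[s,t]}$. A quasi-geodesic $\gamma$ is $C$-(strongly) contracting if for each ball $B$ disjoint from $\gamma$, $\mathrm{diam}(\pi_\gamma(B))\le C$, where $\pi_\gamma:X\to2^\gamma$ is the closest point projection. $X$ is Morse dichotomous if for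 every Morse gauge $M$ there is $C$ such that all $M$-Morse geodesics are $C$-strongly contracting. *)

theory Defs
  imports "HOL-Analysis.Analysis"
begin

definition geodesic_on :: "real set \<Rightarrow> (real \<Rightarrow> 'a::metric_space) \<Rightarrow> bool" where
  "geodesic_on I \<gamma> \<longleftrightarrow>
     is_interval I \<and> (\<forall>s\<in>I. \<forall>t\<in>I. dist (\<gamma> s) (\<gamma> t) = \<bar>s - t\<bar>)"

definition geodesic_space :: "'a::metric_space itself \<Rightarrow> bool" where
  "geodesic_space _ \<longleftrightarrow>
     (\<forall>x y :: 'a. \<exists>\<gamma>. geodesic_on {0..dist x y} \<gamma> \<and> \<gamma> 0 = x \<and> \<gamma> (dist x y) = y)"

definition geodesic_combing :: "('a::metric_space \<Rightarrow> 'a \<Rightarrow> real \<Rightarrow> 'a) \<Rightarrow> bool" where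
  "geodesic_combing q \<longleftrightarrow>
     (\<forall>x y. geodesic_on {0..dist x y} (q x y)
          \<and> (\<forall>t\<le>0. q x y t = x) \<and> (\<forall>t\<ge>dist x y. q x y t = y))"

definition bounded_geodesic_combing :: "('a::metric_space \<Rightarrow> 'a \<Rightarrow> real \<Rightarrow> 'a) \<Rightarrow> bool" where
  "bounded_geodesic_combing q \<longleftrightarrow>
     geodesic_combing q \<and>
     (\<exists>\<kappa>\<^sub>0\<ge>0. \<forall>x y\<^sub>1 y\<^sub>2 t. dist (q x y\<^sub>1 t) (q x y\<^sub>2 t) \<le> \<kappa>\<^sub>0 * dist y\<^sub>1 y\<^sub>2 + \<kappa>\<^sub>0)"

text \<open>The length is the supremum over all partitions \<open>a = t 0 \<le> \<dots> \<le> t n = b\<close>; it may be infinite.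
  It is only meaningful for \<open>a \<le> b\<close>.\<close>

definition curve_length :: "(real \<Rightarrow> 'a::metric_space) \<Rightarrow> real \<Rightarrow> real \<Rightarrow> ereal" where
  "curve_length \<gamma> a b =
     (SUP (n, t) \<in> {(n::nat, t::nat \<Rightarrow> real). mono_on {..n} t \<and> t 0 = a \<and> t n = b}.
        ereal (\<Sum>i<n. dist (\<gamma> (t i)) (\<gamma> (t (Suc i)))))"

text \<open>Quasi-geodesics are improved by convention: continuity and the length bound, with constants
  determined by \<open>Q\<close> and \<open>q\<close>, are part of the notion.\<close>

definition quasi_geodesic_on :: "real \<Rightarrow> real \<Rightarrow> real set \<Rightarrow> (real \<Rightarrow> 'a::metric_space) \<Rightarrow> bool" where
  "quasi_geodesic_on Q q I \<gamma> \<longleftrightarrow>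
     is_interval I \<and>
     (\<forall>s\<in>I. \<forall>t\<in>I. 1 / Q * \<bar>s - t\<bar> - q \<le> dist (\<gamma> s) (\<gamma> t)
                \<and> dist (\<gamma> s) (\<gamma> t) \<le> Q * \<bar>s - t\<bar> + q) \<and>
     continuous_on I \<gamma> \<and>
     (let q' = 2 * (Q + q); k\<^sub>1 = Q * (Q + q); k\<^sub>2 = (Q * q' + 3) * (Q + q)
      in \<forall>s\<in>I. \<forall>t\<in>I. s \<le> t \<longrightarrow>
           curve_length \<gamma> s t \<le> ereal (k\<^sub>1 * dist (\<gamma> s) (\<gamma> t) + k\<^sub>2))"

text \<open>Values of a gauge outside \<open>Q \<ge> 1\<close>, \<open>q \<ge> 0\<close> are irrelevant.\<close>

definition morse_gauge :: "(real \<Rightarrow> real \<Rightarrow> real) \<Rightarrow> bool" where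
  "morse_gauge M \<longleftrightarrow>
     (\<forall>Q\<ge>1. \<forall>q\<ge>0. M Q q \<ge> 0) \<and>
     (\<forall>q\<ge>0. mono_on {1..} (\<lambda>Q. M Q q)) \<and>
     (\<forall>Q\<ge>1. mono_on {0..} (M Q)) \<and>
     (\<forall>Q\<ge>1. continuous_on {0..} (M Q))"

text \<open>Neighbourhoods are closed, so that a gauge may take the value \<open>0\<close>.\<close>

definition morse_on :: "(real \<Rightarrow> real \<Rightarrow> real) \<Rightarrow> real set \<Rightarrow> (real \<Rightarrow> 'a::metric_space) \<Rightarrow> bool" where
  "morse_on M I \<gamma> \<longleftrightarrow>
     (\<forall>Q\<ge>1. \<forall>q\<ge>0. \<forall>s\<in>I. \<forall>t\<in>I. s \<le> t \<longrightarrow>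
        (\<forall>a b \<sigma>. a \<le> b \<and> quasi_geodesic_on Q q {a..b} \<sigma> \<and> \<sigma> a = \<gamma> s \<and> \<sigma> b = \<gamma> t \<longrightarrow>
           (\<forall>u\<in>{a..b}. infdist (\<sigma> u) (\<gamma> ` {s..t}) \<le> M Q q)))"

definition closest_points :: "'a::metric_space set \<Rightarrow> 'a \<Rightarrow> 'a set" where
  "closest_points A x = {p \<in> A. \<forall>p'\<in>A. dist x p \<le> dist x p'}"

text \<open>The explicit boundedness condition is needed because \<^const>\<open>diameter\<close> is unspecified on
  unbounded sets.\<close>

definition strongly_contracting_on :: "real \<Rightarrow> real set \<Rightarrow> (real \<Rightarrow> 'a::metric_space) \<Rightarrow> bool" where
  "strongly_contracting_on C I \<gamma> \<longleftrightarrow>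
     (\<forall>x r. ball x r \<inter> \<gamma> ` I = {} \<longrightarrow>
        (let P = (\<Union>y\<in>ball x r. closest_points (\<gamma> ` I) y) in bounded P \<and> diameter P \<le> C))"

definition morse_dichotomous :: "'a::metric_space itself \<Rightarrow> bool" where
  "morse_dichotomous _ \<longleftrightarrow>
     (\<forall>M. morse_gauge M \<longrightarrow>
        (\<exists>C. \<forall>I (\<gamma> :: real \<Rightarrow> 'a).
           geodesic_on I \<gamma> \<and> morse_on M I \<gamma> \<longrightarrow> strongly_contracting_on C I \<gamma>))"

end

theory Submission
  imports Defs
begin

text \<open>Restrict to a compact subsegment. A pair of points at distance at most a quarter of the height
  whose feet are far apart yields a quasi-geodesic leaving the Morse neighbourhood, so nearest-point
  projection to a Morse geodesic is sublinearly contracting; hence a path of length linear in the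
  distance \<open>s\<close> of its endpoints on \<open>\<gamma>\<close> comes uniformly close to the middle third between them.
  With the bounded combing one can cheaply join \<open>[x,\<pi> x]\<close> to \<open>[x,z]\<close> at a fixed distance from \<open>x\<close>,
  however far away \<open>x\<close> is, so \<open>[x,z]\<close> itself comes close to that middle third as soon as the height
  of \<open>z\<close> is linear in \<open>s\<close>. Now suppose \<open>d(x,y) \<le> D = d(x,\<gamma>)\<close> with feet at distance \<open>s\<close>.
  The combing lines from \<open>x\<close> to the points \<open>y'\<close> of \<open>[\<pi> y,y]\<close>, evaluated at time \<open>D\<close>, move from height
  below \<open>s\<close> to the height of \<open>y\<close>. If \<open>y\<close> has height at most \<open>s\<close>, this already contradicts the previous
  statement. Otherwise some \<open>z\<close> among them has height about \<open>s\<close>; its foot must be close to that of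
  \<open>x\<close>, and \<open>[z,y']\<close> passes near some \<open>\<gamma>(u)\<close> between the feet of \<open>z\<close> and \<open>y\<close>. This forces
  \<open>d(x,\<gamma>(u)) \<ge> D + s - const\<close>, although \<open>\<gamma>(u)\<close> is at distance at most \<open>5s/6\<close> from the foot of \<open>x\<close>.\<close>

section \<open>Discrete paths with bounded steps\<close>

text \<open>Discrete, because the additive constant of the combing bound lets a fan of combing lines
  jump as its endpoint moves; \<open>n\<close> plays the role of length.\<close>

definition coarse_path :: "real \<Rightarrow> 'a::metric_space set \<Rightarrow> nat \<Rightarrow> 'a \<Rightarrow> 'a \<Rightarrow> bool" where
  "coarse_path c A n x y \<longleftrightarrow>
     (\<exists>z. z 0 = x \<and> z n = y \<and> (\<forall>i<n. dist (z i) (z (Suc i)) \<le> c) \<and> (\<forall>i\<le>n. z i \<in> A))"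

lemma coarse_path_rev:
  assumes "coarse_path c A n x y"
  shows "coarse_path c A n y x"
proof -
  obtain z where z: "z 0 = x" "z n = y" "\<And>i. i < n \<Longrightarrow> dist (z i) (z (Suc i)) \<le> c"
      "\<And>i. i \<le> n \<Longrightarrow> z i \<in> A"
    using assms unfolding coarse_path_def by blast
  have "dist (z (n - i)) (z (n - Suc i)) \<le> c" if "i < n" for i
    using z(3)[of "n - Suc i"] that by (simp add: dist_commute Suc_diff_Suc)
  then show ?thesis
    unfolding coarse_path_def using z by (intro exI[of _ "\<lambda>i. z (n - i)"]) auto
qed

lemma coarse_path_append:
  assumes "coarse_path c A n x y" "coarse_path c B m y w"
  shows "coarse_path c (A \<union> B) (n + m) x w"
proof -
  obtain z where z: "z 0 = x" "z n = y" "\<And>i. i < n \<Longrightarrow> dist (z i) (z (Suc i)) \<le> c"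
      "\<And>i. i \<le> n \<Longrightarrow> z i \<in> A"
    using assms(1) unfolding coarse_path_def by blast
  obtain z' where z': "z' 0 = y" "z' m = w" "\<And>i. i < m \<Longrightarrow> dist (z' i) (z' (Suc i)) \<le> c"
      "\<And>i. i \<le> m \<Longrightarrow> z' i \<in> B"
    using assms(2) unfolding coarse_path_def by blast
  define Z where "Z i = (if i \<le> n then z i else z' (i - n))" for i
  have "Z (n + m) = w"
    using z z' by (cases m) (auto simp: Z_def)
  moreover have "dist (Z i) (Z (Suc i)) \<le> c" if "i < n + m" for i
  proof -
    consider "i < n" | "i = n" | "i > n" by linarith
    then show ?thesis
    proof cases
      case 1
      then show ?thesis using z(3) by (simp add: Z_def)
    next
      case 2
      then show ?thesis using z(2) z'(1) z'(3)[of 0] that by (simp add: Z_def)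
    next
      case 3
      then show ?thesis using z'(3)[of "i - n"] that by (simp add: Z_def Suc_diff_le)
    qed
  qed
  moreover have "Z i \<in> A \<union> B" if "i \<le> n + m" for i
    using z(4) z'(4) that by (auto simp: Z_def)
  ultimately show ?thesis
    unfolding coarse_path_def using z(1) by (intro exI[of _ Z]) (auto simp: Z_def)
qed

lemma coarse_path_sample:
  fixes f :: "real \<Rightarrow> 'a::metric_space"
  assumes "t0 \<le> t1" "\<And>s t. \<bar>s - t\<bar> \<le> 1 \<Longrightarrow> dist (f s) (f t) \<le> c"
  shows "coarse_path c (f ` {t0..t1}) (nat \<lceil>t1 - t0\<rceil>) (f t0) (f t1)"
proof -
  \<comment> \<open>Clamping at \<open>t1\<close> absorbs the rounding up of the number of
    steps.\<close>
  define z where "z i = f (min (t0 + real i) t1)" for i :: nat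
  have "t1 \<le> t0 + real (nat \<lceil>t1 - t0\<rceil>)" using assms(1) by linarith
  then have "z (nat \<lceil>t1 - t0\<rceil>) = f t1" by (simp add: z_def min.absorb2 del: of_nat_nat)
  moreover have "dist (z i) (z (Suc i)) \<le> c" for i
    unfolding z_def by (rule assms(2)) (auto simp: min_def)
  ultimately show ?thesis
    unfolding coarse_path_def using assms(1) by (intro exI[of _ z]) (auto simp: z_def)
qed

section \<open>Lipschitz curves as improved quasi-geodesics\<close>

lemma curve_length_lipschitz:
  fixes \<sigma> :: "real \<Rightarrow> 'a::metric_space"
  assumes "\<And>s t. s \<in> {a..b} \<Longrightarrow> t \<in> {a..b} \<Longrightarrow> dist (\<sigma> s) (\<sigma> t) \<le> \<bar>s - t\<bar>"
  shows "curve_length \<sigma> a b \<le> ereal (b - a)"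
  unfolding curve_length_def
proof (rule SUP_least, clarify)
  fix n and \<tau> :: "nat \<Rightarrow> real"
  assume m: "mono_on {..n} \<tau>" and ab: "a = \<tau> 0" "b = \<tau> n"
  have in_ab: "\<tau> i \<in> {a..b}" if "i \<le> n" for i
    using m that unfolding ab by (auto intro: mono_onD)
  have "(\<Sum>i<n. dist (\<sigma> (\<tau> i)) (\<sigma> (\<tau> (Suc i)))) \<le> (\<Sum>i<n. \<tau> (Suc i) - \<tau> i)"
  proof (rule sum_mono)
    fix i assume "i \<in> {..<n}"
    then have "dist (\<sigma> (\<tau> i)) (\<sigma> (\<tau> (Suc i))) \<le> \<bar>\<tau> i - \<tau> (Suc i)\<bar>" "\<tau> i \<le> \<tau> (Suc i)"
      using m by (auto intro!: assms in_ab intro: mono_onD)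
    then show "dist (\<sigma> (\<tau> i)) (\<sigma> (\<tau> (Suc i))) \<le> \<tau> (Suc i) - \<tau> i" by linarith
  qed
  also have "\<dots> = \<tau> n - \<tau> 0" by (rule sum_lessThan_telescope)
  finally show "ereal (\<Sum>i<n. dist (\<sigma> (\<tau> i)) (\<sigma> (\<tau> (Suc i)))) \<le> ereal (\<tau> n - \<tau> 0)"
    by simp
qed

text \<open>The length condition of the convention comes for free: the length is at most
  \<open>t - s\<close>, which \<open>lower\<close> bounds by \<open>Q\<close> times the distance,
  and for \<open>q = 0\<close> the factor \<open>k\<^sub>1\<close> is \<open>Q * Q\<close>.\<close>

lemma quasi_geodesic_on_lipschitz:
  fixes \<sigma> :: "real \<Rightarrow> 'a::metric_space"
  assumes Q: "1 \<le> Q"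
    and upper: "\<And>s t. s \<in> {a..b} \<Longrightarrow> t \<in> {a..b} \<Longrightarrow> dist (\<sigma> s) (\<sigma> t) \<le> \<bar>s - t\<bar>"
    and lower: "\<And>s t. s \<in> {a..b} \<Longrightarrow> t \<in> {a..b} \<Longrightarrow> \<bar>s - t\<bar> \<le> Q * dist (\<sigma> s) (\<sigma> t)"
  shows "quasi_geodesic_on Q 0 {a..b} \<sigma>"
proof -
  have "continuous_on {a..b} \<sigma>"
    by (rule continuous_on_iff[THEN iffD2])
      (metis upper dist_real_def order_le_less_trans)
  moreover have "dist (\<sigma> s) (\<sigma> t) \<le> Q * \<bar>s - t\<bar>" if "s \<in> {a..b}" "t \<in> {a..b}" for s t
    using upper[OF that] mult_right_mono[OF Q, of "\<bar>s - t\<bar>"] by simp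
  moreover have "\<bar>s - t\<bar> / Q \<le> dist (\<sigma> s) (\<sigma> t)" if "s \<in> {a..b}" "t \<in> {a..b}" for s t
    using lower[OF that] Q by (simp add: divide_le_eq mult.commute)
  moreover have "curve_length \<sigma> s t \<le> ereal (Q * Q * dist (\<sigma> s) (\<sigma> t) + (Q * (2 * Q) + 3) * Q)"
    if st: "s \<in> {a..b}" "t \<in> {a..b}" "s \<le> t" for s t
  proof -
    have "curve_length \<sigma> s t \<le> ereal (t - s)"
      using st by (intro curve_length_lipschitz upper) auto
    moreover have "t - s \<le> Q * dist (\<sigma> s) (\<sigma> t)" using lower[OF st(1,2)] st(3) by simp
    moreover have "Q * dist (\<sigma> s) (\<sigma> t) \<le> Q * (Q * dist (\<sigma> s) (\<sigma> t))"
      using Q mult_right_mono[OF Q, of "dist (\<sigma> s) (\<sigma> t)"] by (intro mult_left_mono) auto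
    moreover have "0 \<le> (Q * (2 * Q) + 3) * Q" using Q by simp
    ultimately have "curve_length \<sigma> s t \<le> ereal (t - s)"
      "t - s \<le> Q * Q * dist (\<sigma> s) (\<sigma> t) + (Q * (2 * Q) + 3) * Q"
      by (auto simp: mult.assoc)
    then show ?thesis by (meson ereal_less_eq(3) order_trans)
  qed
  ultimately show ?thesis
    unfolding quasi_geodesic_on_def Let_def by (auto simp: is_interval_cc)
qed

section \<open>Metric properties of combing lines\<close>

locale combing =
  fixes q :: "'a::metric_space \<Rightarrow> 'a \<Rightarrow> real \<Rightarrow> 'a" and \<kappa> :: real
  assumes geodesic_combing: "geodesic_combing q"
    and \<kappa>_nonneg: "0 \<le> \<kappa>"
    and combing_bound: "dist (q x y\<^sub>1 t) (q x y\<^sub>2 t) \<le> \<kappa> * dist y\<^sub>1 y\<^sub>2 + \<kappa>"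
begin

lemma comb_clamp: "q x y t = q x y (max 0 (min t (dist x y)))"
  using geodesic_combing unfolding geodesic_combing_def
  by (metis max.absorb1 max.absorb2 min.absorb1 min.absorb2 nle_le zero_le_dist)

lemma comb_0 [simp]: "q x y 0 = x"
  and comb_end: "dist x y \<le> t \<Longrightarrow> q x y t = y"
  and comb_dist_inner:
    "s \<in> {0..dist x y} \<Longrightarrow> t \<in> {0..dist x y} \<Longrightarrow> dist (q x y s) (q x y t) = \<bar>s - t\<bar>"
  using geodesic_combing unfolding geodesic_combing_def geodesic_on_def by auto

lemma comb_dist:
  "dist (q x y s) (q x y t) = \<bar>max 0 (min s (dist x y)) - max 0 (min t (dist x y))\<bar>"
  by (subst (1 2) comb_clamp, rule comb_dist_inner) auto

lemma comb_lipschitz: "dist (q x y s) (q x y t) \<le> \<bar>s - t\<bar>"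
  unfolding comb_dist by (simp add: max_def min_def)

lemma continuous_comb [continuous_intros]:
  assumes "continuous_on S f"
  shows "continuous_on S (\<lambda>z. q x y (f z))"
proof -
  have "continuous_on UNIV (q x y)"
    by (rule continuous_on_iff[THEN iffD2])
      (metis comb_lipschitz dist_real_def order_le_less_trans)
  from continuous_on_compose2[OF this assms] show ?thesis by simp
qed

lemma comb_dist_start: "dist x (q x y t) = max 0 (min t (dist x y))"
  using comb_dist[of x y 0 t] by simp

lemma comb_between: "dist x (q x y t) + dist (q x y t) y = dist x y"
  using comb_dist[of x y 0 t] comb_dist[of x y t "dist x y"]
  by (simp add: comb_end max_def min_def split: if_splits)

lemma comb_unit_step: "\<bar>s - t\<bar> \<le> 1 \<Longrightarrow> dist (q x y s) (q x y t) \<le> 2 * \<kappa> + 1"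
  using comb_lipschitz[of x y s t] \<kappa>_nonneg by linarith

lemma comb_fan_unit_step:
  assumes "\<bar>s - t\<bar> \<le> 1"
  shows "dist (q x (q y z s) \<tau>) (q x (q y z t) \<tau>) \<le> 2 * \<kappa>"
proof -
  have "\<kappa> * dist (q y z s) (q y z t) \<le> \<kappa> * 1"
    using comb_lipschitz[of y z s t] assms \<kappa>_nonneg by (intro mult_left_mono) auto
  then show ?thesis using combing_bound[of x "q y z s" \<tau> "q y z t"] by linarith
qed

end

section \<open>Nearest points on a compact Morse segment\<close>

locale morse_segment = combing q \<kappa>
  for q :: "'a::metric_space \<Rightarrow> 'a \<Rightarrow> real \<Rightarrow> 'a" and \<kappa> :: real +
  fixes \<gamma> :: "real \<Rightarrow> 'a" and a b :: real and M :: "real \<Rightarrow> real \<Rightarrow> real"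
  assumes ab: "a \<le> b"
    and geodesic: "geodesic_on {a..b} \<gamma>"
    and morse: "morse_on M {a..b} \<gamma>"
begin

text \<open>Feet are recorded as parameters, so that distances between them are differences of
  reals.\<close>

definition foot :: "'a \<Rightarrow> real \<Rightarrow> bool" where
  "foot x u \<longleftrightarrow> u \<in> {a..b} \<and> (\<forall>w\<in>{a..b}. dist x (\<gamma> u) \<le> dist x (\<gamma> w))"

lemma foot_in: "foot x u \<Longrightarrow> u \<in> {a..b}"
  and foot_le: "foot x u \<Longrightarrow> w \<in> {a..b} \<Longrightarrow> dist x (\<gamma> u) \<le> dist x (\<gamma> w)"
  unfolding foot_def by auto

lemma \<gamma>_dist: "s \<in> {a..b} \<Longrightarrow> t \<in> {a..b} \<Longrightarrow> dist (\<gamma> s) (\<gamma> t) = \<bar>s - t\<bar>"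
  using geodesic unfolding geodesic_on_def by blast

lemma foot_ex: "\<exists>u. foot x u"
proof -
  have "continuous_on {a..b} \<gamma>"
    by (rule continuous_on_iff[THEN iffD2]) (metis \<gamma>_dist dist_real_def)
  then have "continuous_on {a..b} (\<lambda>t. dist x (\<gamma> t))" by (intro continuous_intros)
  from continuous_attains_inf[OF compact_Icc _ this] show ?thesis
    using ab unfolding foot_def by auto
qed

lemma foot_on: "u \<in> {a..b} \<Longrightarrow> foot (\<gamma> u) u"
  unfolding foot_def by simp

text \<open>Moving from \<open>x\<close> to \<open>m\<close> lowers the distance to
  \<open>\<gamma> u\<close> by exactly \<open>dist m x\<close>, and that to any other point by at
  most this.\<close>

lemma foot_between:
  assumes "foot x u" "dist (\<gamma> u) m + dist m x = dist (\<gamma> u) x"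
  shows "foot m u"
  unfolding foot_def
proof (intro conjI ballI)
  fix w assume "w \<in> {a..b}"
  then show "dist m (\<gamma> u) \<le> dist m (\<gamma> w)"
    using foot_le[OF assms(1), of w] assms(2) dist_triangle[of x "\<gamma> w" m]
    by (simp add: dist_commute)
qed (use foot_in assms(1) in auto)

lemma foot_infdist:
  assumes "foot x u" shows "infdist x (\<gamma> ` {a..b}) = dist x (\<gamma> u)"
proof (rule antisym)
  show "infdist x (\<gamma> ` {a..b}) \<le> dist x (\<gamma> u)"
    using foot_in[OF assms] by (intro infdist_le) auto
  show "dist x (\<gamma> u) \<le> infdist x (\<gamma> ` {a..b})"
    using foot_le[OF assms] ab by (auto simp: infdist_notempty intro: cINF_greatest)
qed

text \<open>\<open>morse_on\<close> speaks only of paths running in the direction of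
  \<open>\<gamma>\<close>; the other direction is reduced to it by reversing
  \<open>\<sigma>\<close>.\<close>

lemma infdist_lipschitz_quasi_geodesic:
  assumes Q: "1 \<le> Q"
    and upper: "\<And>s t. s \<in> {0..l} \<Longrightarrow> t \<in> {0..l} \<Longrightarrow> dist (\<sigma> s) (\<sigma> t) \<le> \<bar>s - t\<bar>"
    and lower: "\<And>s t. s \<in> {0..l} \<Longrightarrow> t \<in> {0..l} \<Longrightarrow> \<bar>s - t\<bar> \<le> Q * dist (\<sigma> s) (\<sigma> t)"
    and ends: "\<sigma> 0 = \<gamma> u" "\<sigma> l = \<gamma> v" "u \<in> {a..b}" "v \<in> {a..b}"
    and t: "t \<in> {0..l}"
  shows "infdist (\<sigma> t) (\<gamma> ` {a..b}) \<le> M Q 0"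
proof -
  have oriented: "infdist (\<sigma>' t') (\<gamma> ` {a..b}) \<le> M Q 0"
    if "quasi_geodesic_on Q 0 {0..l} \<sigma>'" "\<sigma>' 0 = \<gamma> u'" "\<sigma>' l = \<gamma> v'" "u' \<le> v'"
      "u' \<in> {a..b}" "v' \<in> {a..b}" "t' \<in> {0..l}" for \<sigma>' t' u' v'
  proof -
    have "infdist (\<sigma>' t') (\<gamma> ` {u'..v'}) \<le> M Q 0"
      using morse[unfolded morse_on_def, rule_format, OF Q order_refl, of u' v' 0 l \<sigma>'] that t
      by auto
    moreover have "infdist (\<sigma>' t') (\<gamma> ` {a..b}) \<le> infdist (\<sigma>' t') (\<gamma> ` {u'..v'})"
      using that by (intro infdist_mono) auto
    ultimately show ?thesis by linarith
  qed
  show ?thesis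
  proof (cases "u \<le> v")
    case True
    then show ?thesis
      using ends t by (intro oriented quasi_geodesic_on_lipschitz Q upper lower)
  next
    case False
    have "quasi_geodesic_on Q 0 {0..l} (\<lambda>t. \<sigma> (l - t))"
    proof (rule quasi_geodesic_on_lipschitz[OF Q])
      fix s t assume "s \<in> {0..l}" "t \<in> {0..l}"
      then show "dist (\<sigma> (l - s)) (\<sigma> (l - t)) \<le> \<bar>s - t\<bar>"
          "\<bar>s - t\<bar> \<le> Q * dist (\<sigma> (l - s)) (\<sigma> (l - t))"
        using upper[of "l - s" "l - t"] lower[of "l - s" "l - t"] by (auto simp: abs_minus_commute)
    qed
    from oriented[OF this, of v u "l - t"] False ends t show ?thesis by simp
  qed
qed

section \<open>Sublinear contraction of the projection\<close>

text \<open>If the feet were far apart, one could go up from one foot towards \<open>x\<close>, cross over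
  to the geodesic from the other foot to \<open>y\<close> at the lowest height \<open>h\<close> at which the gap is at most
  \<open>h / 3\<close>, and go down there. This is a quasi-geodesic that leaves the Morse neighbourhood.\<close>

lemma foot_sublinear:
  assumes x: "foot x u" and y: "foot y v"
    and D: "D = dist x (\<gamma> u)" "0 < D" and xy: "dist x y \<le> D / 4"
    and \<epsilon>: "0 < \<epsilon>" "\<epsilon> \<le> 1" and M: "4 * M (80 / \<epsilon>) 0 \<le> \<epsilon> * D"
  shows "\<bar>u - v\<bar> \<le> \<epsilon> * D"
proof (rule ccontr)
  assume contra: "\<not> \<bar>u - v\<bar> \<le> \<epsilon> * D"
  define L where "L = \<bar>u - v\<bar>"
  have L: "L > \<epsilon> * D" "L > 0"
    using contra \<epsilon> D(2) mult_pos_pos[of \<epsilon> D] unfolding L_def by linarith+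
  define E where "E = dist y (\<gamma> v)"
  define A where "A = q (\<gamma> u) x"
  define B where "B = q (\<gamma> v) y"
  have uv: "u \<in> {a..b}" "v \<in> {a..b}" using foot_in x y by auto
  have E: "E \<le> 5 * D / 4" "3 * D / 4 \<le> E"
    using foot_le[OF y uv(1)] foot_le[OF x uv(2)] xy D dist_triangle[of y "\<gamma> u" x]
      dist_triangle[of x "\<gamma> v" y] unfolding E_def by (auto simp: dist_commute)
  have A_foot: "foot (A k) u" for k
    using foot_between[OF x] comb_between unfolding A_def by blast
  have B_foot: "foot (B k) v" for k
    using foot_between[OF y] comb_between unfolding B_def by blast
  have A_ht: "dist (A k) (\<gamma> u) = k" if "k \<in> {0..D}" for k
    using comb_dist_start[of "\<gamma> u" x k] that unfolding A_def D by (simp add: dist_commute)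
  have B_ht: "dist (B k) (\<gamma> v) = k" if "k \<in> {0..E}" for k
    using comb_dist_start[of "\<gamma> v" y k] that unfolding B_def E_def by (simp add: dist_commute)
  have AA: "dist (A k) (A k') = \<bar>k - k'\<bar>" if "k \<in> {0..D}" "k' \<in> {0..D}" for k k'
    using comb_dist_inner that unfolding A_def D by (simp add: dist_commute)
  have BB: "dist (B k) (B k') = \<bar>k - k'\<bar>" if "k \<in> {0..E}" "k' \<in> {0..E}" for k k'
    using comb_dist_inner that unfolding B_def E_def by (simp add: dist_commute)
  \<comment> \<open>The distance to the segment is 1-Lipschitz; it is \<open>k\<close> at
    \<open>A k\<close> and \<open>h\<close> at \<open>B h\<close>.\<close>
  have AB1: "\<bar>k - h\<bar> \<le> dist (A k) (B h)" if "k \<in> {0..D}" "h \<in> {0..E}" for k h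
    using foot_le[OF A_foot[of k] uv(2)] foot_le[OF B_foot[of h] uv(1)] A_ht[OF that(1)]
      B_ht[OF that(2)] dist_triangle[of "A k" "\<gamma> v" "B h"] dist_triangle[of "B h" "\<gamma> u" "A k"]
    by (auto simp: dist_commute)
  have AB2: "L - k - h \<le> dist (A k) (B h)" if "k \<in> {0..D}" "h \<in> {0..E}" for k h
    using \<gamma>_dist[OF uv] A_ht[OF that(1)] B_ht[OF that(2)] dist_triangle[of "\<gamma> u" "\<gamma> v" "A k"]
      dist_triangle[of "A k" "\<gamma> v" "B h"] unfolding L_def by (simp add: dist_commute)
  \<comment> \<open>The pairs of heights between which crossing is cheap. \<open>(E, D)\<close> is
    one of them because \<open>D / 4 \<le> E / 3\<close>, and compactness gives a lowest
    crossing.\<close>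
  define K where "K = ({0..E} \<times> {0..D}) \<inter> {z. dist (B (fst z)) (A (snd z)) \<le> fst z / 3}"
  have "closed {z. dist (B (fst z)) (A (snd z)) \<le> fst z / 3}"
    unfolding A_def B_def by (intro closed_Collect_le continuous_intros) auto
  then have "compact K"
    unfolding K_def by (intro compact_Int_closed compact_Times compact_Icc)
  moreover have "(E, D) \<in> K"
  proof -
    have "A D = x" "B E = y" unfolding A_def B_def D E_def by (auto simp: comb_end dist_commute)
    then show ?thesis using xy D E unfolding K_def by (auto simp: dist_commute)
  qed
  moreover have "continuous_on K fst" by (intro continuous_intros)
  ultimately obtain z where z: "z \<in> K" "\<And>z'. z' \<in> K \<Longrightarrow> fst z \<le> fst z'"
    using continuous_attains_inf[of K fst] by blast
  obtain h' k0 where hk: "z = (h', k0)" by force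
  have h': "h' \<in> {0..E}" and k0: "k0 \<in> {0..D}" and bridge_le: "dist (B h') (A k0) \<le> h' / 3"
    using z(1) unfolding hk K_def by auto
  have gap': "h / 3 < dist (B h) (A k)" if "h \<in> {0..E}" "h < h'" "k \<in> {0..D}" for h k
    using z(2)[of "(h, k)"] that unfolding hk K_def by (auto simp: not_le[symmetric])
  \<comment> \<open>\<open>AB1\<close> gives \<open>k0 \<le> 4 * h' / 3\<close>; then
    \<open>AB2\<close> gives \<open>L \<le> h' / 3 + k0 + h' \<le> 8 * h' / 3\<close>.\<close>
  have h'_L: "3 * L / 8 \<le> h'"
    using AB1[OF k0 h'] AB2[OF k0 h'] bridge_le by (simp add: dist_commute)
  have k0_bounds: "2 * h' / 3 \<le> k0" "k0 \<le> 4 * h' / 3"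
    using AB1[OF k0 h'] bridge_le by (auto simp: dist_commute)
  have gap: "h / 3 \<le> dist (B h) (A k)" if h: "h \<in> {0..h'}" and k: "k \<in> {0..D}" for h k
  proof (cases "h < h'")
    case True
    then show ?thesis using gap'[of h k] h k h' by auto
  next
    case False
    then have hh: "h = h'" using h by auto
    \<comment> \<open>Minimality of \<open>h'\<close> says something only below \<open>h'\<close>,
      so the bound at \<open>h'\<close> is obtained as a limit.\<close>
    show ?thesis unfolding hh
    proof (rule field_le_epsilon)
      fix e :: real assume e: "0 < e"
      define d where "d = min (e / 2) h'"
      have d: "0 < d" "d \<le> h'" "d \<le> e / 2" using e h'_L L unfolding d_def by auto
      then have "(h' - d) / 3 < dist (B (h' - d)) (A k)" using gap'[of "h' - d" k] h' k by auto
      moreover have "dist (B (h' - d)) (B h') = d" using BB[of "h' - d" h'] d h' by auto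
      ultimately show "h' / 3 \<le> dist (B h') (A k) + e"
        using dist_triangle[of "B (h' - d)" "A k" "B h'"] d by simp
    qed
  qed
  define c where "c = h' / 3"
  have c: "dist (A k0) (B h') = c" "0 \<le> c"
    using gap[of h' k0] bridge_le h' k0 unfolding c_def by (auto simp: dist_commute)
  define C where "C = q (A k0) (B h')"
  have CA: "dist (A k0) (C \<tau>) = \<tau>" if "\<tau> \<in> {0..c}" for \<tau>
    using comb_dist_start[of "A k0" "B h'" \<tau>] that c unfolding C_def by simp
  have CB: "dist (C \<tau>) (B h') = c - \<tau>" if "\<tau> \<in> {0..c}" for \<tau>
    using comb_between[of "A k0" "B h'" \<tau>] CA[OF that] c unfolding C_def by simp
  have CC: "dist (C s) (C t) = \<bar>s - t\<bar>" if "s \<in> {0..c}" "t \<in> {0..c}" for s t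
    using comb_dist_inner[of s "A k0" "B h'" t] that c unfolding C_def by simp
  \<comment> \<open>In the case \<open>across\<close> the distance exceeds
    \<open>\<epsilon> * D / 24\<close> while the parameters differ by at most
    \<open>10 * D / 3\<close>, and \<open>24 * 10 / 3 = 80\<close>.\<close>
  define Q where "Q = 80 / \<epsilon>"
  have Q: "5 \<le> Q" using \<epsilon> unfolding Q_def by (simp add: le_divide_eq)
  define \<sigma> where "\<sigma> t = (if t \<le> k0 then A t else if t \<le> k0 + c then C (t - k0)
    else B (h' - (t - k0 - c)))" for t
  define l where "l = k0 + c + h'"
  have main: "dist (\<sigma> s) (\<sigma> t) \<le> t - s \<and> t - s \<le> Q * dist (\<sigma> s) (\<sigma> t)"
    if st: "0 \<le> s" "s \<le> t" "t \<le> l" for s t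
  proof -
    \<comment> \<open>Every case but \<open>across\<close> achieves the constant 5: by
      \<open>gap\<close> the bridge is a shortest way from \<open>B h'\<close> to leg
      \<open>A\<close>, and \<open>B h\<close> keeps distance at least \<open>h / 3\<close> from the
      start \<open>A k0\<close> of the bridge.\<close>
    have five: "r \<le> Q * d" if "r \<le> 5 * d" "0 \<le> d" for r d
      using mult_right_mono[OF Q that(2)] that(1) by linarith
    consider (legA) "t \<le> k0" | (bridge_up) "s \<le> k0" "k0 < t" "t \<le> k0 + c" | (across) "s \<le> k0" "k0 + c < t"
      | (legC) "k0 < s" "t \<le> k0 + c" | (bridge_down) "k0 < s" "s \<le> k0 + c" "k0 + c < t" | (legB) "k0 + c < s"
      by linarith
    then show ?thesis
    proof cases
      case legA
      then have "dist (\<sigma> s) (\<sigma> t) = t - s" using st k0 by (auto simp: \<sigma>_def AA)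
      with st Q five show ?thesis by simp
    next
      case legC
      then have "dist (\<sigma> s) (\<sigma> t) = t - s" using st k0 by (auto simp: \<sigma>_def CC)
      with st Q five show ?thesis by simp
    next
      case legB
      then have "dist (\<sigma> s) (\<sigma> t) = t - s" using st k0 c h' by (auto simp: \<sigma>_def BB l_def)
      with st Q five show ?thesis by simp
    next
      case bridge_up
      define \<tau> where "\<tau> = t - k0"
      have \<tau>: "\<tau> \<in> {0..c}" "s \<in> {0..D}" using bridge_up st k0 unfolding \<tau>_def by auto
      have eq: "\<sigma> s = A s" "\<sigma> t = C \<tau>" using bridge_up c unfolding \<sigma>_def \<tau>_def by auto
      have "c \<le> dist (B h') (A s)" using gap[of h' s] h' \<tau> unfolding c_def by auto
      moreover have "dist (A s) (A k0) = k0 - s" using AA[OF \<tau>(2) k0] bridge_up by simp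
      ultimately have "dist (A s) (C \<tau>) \<le> (k0 - s) + \<tau>" "\<tau> \<le> dist (A s) (C \<tau>)"
        "k0 - s - \<tau> \<le> dist (A s) (C \<tau>)"
        using CA[OF \<tau>(1)] CB[OF \<tau>(1)] dist_triangle[of "A s" "C \<tau>" "A k0"]
          dist_triangle[of "B h'" "A s" "C \<tau>"] dist_triangle[of "A s" "A k0" "C \<tau>"]
        by (auto simp: dist_commute)
      then show ?thesis unfolding eq using five[of "t - s" "dist (A s) (C \<tau>)"]
        unfolding \<tau>_def by auto
    next
      case bridge_down
      define \<tau> where "\<tau> = s - k0"
      define h where "h = h' - (t - k0 - c)"
      have \<tau>: "\<tau> \<in> {0..c}" "h \<in> {0..h'}" "h \<in> {0..E}"
        using bridge_down st k0 h' unfolding \<tau>_def h_def l_def by auto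
      have eq: "\<sigma> s = C \<tau>" "\<sigma> t = B h" using bridge_down c unfolding \<sigma>_def \<tau>_def h_def by auto
      have "h / 3 \<le> dist (B h) (A k0)" using gap \<tau> k0 by blast
      moreover have "dist (B h') (B h) = h' - h" using BB[OF h' \<tau>(3)] \<tau> by simp
      ultimately have "dist (C \<tau>) (B h) \<le> (c - \<tau>) + (h' - h)" "h / 3 - \<tau> \<le> dist (C \<tau>) (B h)"
        "(h' - h) - (c - \<tau>) \<le> dist (C \<tau>) (B h)"
        using CA[OF \<tau>(1)] CB[OF \<tau>(1)] dist_triangle[of "C \<tau>" "B h" "B h'"]
          dist_triangle[of "B h" "A k0" "C \<tau>"] dist_triangle[of "B h'" "B h" "C \<tau>"]
        by (auto simp: dist_commute)
      moreover have "t - s = (c - \<tau>) + (h' - h)" unfolding \<tau>_def h_def by simp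
      ultimately show ?thesis unfolding eq using five[of "t - s" "dist (C \<tau>) (B h)"]
        unfolding c_def by auto
    next
      case across
      define h where "h = h' - (t - k0 - c)"
      have h: "h \<in> {0..h'}" "h \<in> {0..E}" "s \<in> {0..D}"
        using across st k0 h' unfolding h_def l_def by auto
      have eq: "\<sigma> s = A s" "\<sigma> t = B h" using across c unfolding \<sigma>_def h_def by auto
      have ts: "t - s = (k0 - s) + c + (h' - h)" unfolding h_def by simp
      have "dist (A s) (A k0) = k0 - s" using AA[OF h(3) k0] across by simp
      moreover have "dist (B h') (B h) = h' - h" using BB[OF h' h(2)] h by simp
      ultimately have "dist (A s) (B h) \<le> t - s"
        using dist_triangle[of "A s" "B h" "A k0"] dist_triangle[of "A k0" "B h" "B h'"] c ts
        by linarith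
      moreover have "L / 24 \<le> dist (A s) (B h)"
        using gap[OF h(1,3)] AB1[OF h(3,2)] AB2[OF h(3,2)] L(2) by (simp add: dist_commute)
      moreover have "t - s \<le> 10 * D / 3"
        using ts k0_bounds h h' E across st unfolding c_def by auto
      ultimately have d: "dist (A s) (B h) \<le> t - s" "\<epsilon> * D \<le> 24 * dist (A s) (B h)"
        "t - s \<le> 10 * D / 3" using L by auto
      have "\<epsilon> * (t - s) \<le> \<epsilon> * (10 * D / 3)"
        using d(3) \<epsilon> by (intro mult_left_mono) auto
      then have "\<epsilon> * (t - s) \<le> 80 * dist (A s) (B h)" using d(2) by simp
      then have "t - s \<le> Q * dist (A s) (B h)"
        unfolding Q_def using \<epsilon> by (simp add: field_simps)
      with d show ?thesis unfolding eq by simp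
    qed
  qed
  \<comment> \<open>The point \<open>A k0\<close> has height
    \<open>k0 \<ge> 2 * h' / 3 \<ge> L / 4 > \<epsilon> * D / 4\<close>, whence the factor 4 in the
    hypothesis on \<open>M\<close>.\<close>
  have "infdist (\<sigma> k0) (\<gamma> ` {a..b}) \<le> M Q 0"
  proof (rule infdist_lipschitz_quasi_geodesic[where l = l])
    show "1 \<le> Q" using Q by simp
    show "dist (\<sigma> s) (\<sigma> t) \<le> \<bar>s - t\<bar>" "\<bar>s - t\<bar> \<le> Q * dist (\<sigma> s) (\<sigma> t)"
      if "s \<in> {0..l}" "t \<in> {0..l}" for s t
      using main[of s t] main[of t s] that by (cases "s \<le> t"; simp add: dist_commute)+
    show "\<sigma> 0 = \<gamma> u" using k0 unfolding \<sigma>_def A_def by simp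
    show "\<sigma> l = \<gamma> v" using h' h'_L L c unfolding \<sigma>_def l_def B_def by simp
    show "k0 \<in> {0..l}" using k0 c h' unfolding l_def by simp
  qed (use uv in auto)
  moreover have "infdist (\<sigma> k0) (\<gamma> ` {a..b}) = k0"
    using foot_infdist[OF A_foot] A_ht[OF k0] unfolding \<sigma>_def by simp
  ultimately show False using k0_bounds h'_L L M unfolding Q_def by linarith
qed

section \<open>Short paths come close to the middle third\<close>

text \<open>The middle third between \<open>\<alpha>\<close> and \<open>\<beta>\<close>, written
  symmetrically so that their order does not matter.\<close>

definition middle :: "real \<Rightarrow> real \<Rightarrow> real set" where
  "middle \<alpha> \<beta> = {u. \<bar>\<alpha> - \<beta>\<bar> / 3 \<le> \<bar>u - \<alpha>\<bar> \<and> \<bar>\<alpha> - \<beta>\<bar> / 3 \<le> \<bar>u - \<beta>\<bar>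
     \<and> \<bar>u - \<alpha>\<bar> + \<bar>u - \<beta>\<bar> = \<bar>\<alpha> - \<beta>\<bar>}"

lemma middle_commute: "middle \<alpha> \<beta> = middle \<beta> \<alpha>"
  unfolding middle_def by (auto simp: add.commute abs_minus_commute)

lemma middleD:
  assumes "u \<in> middle \<alpha> \<beta>"
  shows "\<bar>\<alpha> - \<beta>\<bar> / 3 \<le> \<bar>u - \<alpha>\<bar>" "\<bar>\<alpha> - \<beta>\<bar> / 3 \<le> \<bar>u - \<beta>\<bar>"
    "\<bar>u - \<alpha>\<bar> \<le> 2 * \<bar>\<alpha> - \<beta>\<bar> / 3" "\<bar>u - \<beta>\<bar> \<le> 2 * \<bar>\<alpha> - \<beta>\<bar> / 3"
proof -
  have "X \<le> 2 * Z / 3 \<and> Y \<le> 2 * Z / 3"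
    if "Z / 3 \<le> X" "Z / 3 \<le> Y" "X + Y = Z" for X Y Z :: real
    using that by linarith
  then show "\<bar>u - \<alpha>\<bar> \<le> 2 * \<bar>\<alpha> - \<beta>\<bar> / 3" "\<bar>u - \<beta>\<bar> \<le> 2 * \<bar>\<alpha> - \<beta>\<bar> / 3"
    using assms unfolding middle_def by blast+
qed (use assms in \<open>auto simp: middle_def\<close>)

lemma middle_in: "\<alpha> \<in> {a..b} \<Longrightarrow> \<beta> \<in> {a..b} \<Longrightarrow> u \<in> middle \<alpha> \<beta> \<Longrightarrow> u \<in> {a..b}"
  unfolding middle_def by auto

text \<open>If the path stayed away from the middle third, its feet would cross that third while the
  path is at height at least \<open>H\<close>. There \<open>foot_sublinear\<close> makes them so
  slow that they cover at most \<open>s / 6\<close> instead of \<open>s / 3\<close>.\<close>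

lemma middle_recurrence_less:
  assumes c: "1 \<le> c" and \<Lambda>: "1 \<le> \<Lambda>"
    and H: "8 * c \<le> H" "240 * c * \<Lambda> * M (4800 * c * \<Lambda>) 0 \<le> H"
    and path: "coarse_path c A n (\<gamma> \<alpha>) (\<gamma> \<beta>)" and \<alpha>: "\<alpha> \<in> {a..b}" and \<beta>: "\<beta> \<in> {a..b}"
    and le: "\<alpha> \<le> \<beta>" and n: "real n \<le> \<Lambda> * (\<beta> - \<alpha>)" and far: "120 * (H + c) \<le> \<beta> - \<alpha>"
  shows "\<exists>y\<in>A. \<exists>u\<in>middle \<alpha> \<beta>. dist y (\<gamma> u) \<le> H"
proof (rule ccontr)
  assume "\<not> ?thesis"
  then have avoid: "H < dist y (\<gamma> u)" if "y \<in> A" "u \<in> middle \<alpha> \<beta>" for y u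
    using that by force
  define s where "s = \<beta> - \<alpha>"
  \<comment> \<open>Chosen so that \<open>\<epsilon>\<close> times the maximal path length
    \<open>c * \<Lambda> * s\<close> is \<open>s / 60\<close>. The constants in \<open>H(2)\<close>
    are \<open>4 / \<epsilon>\<close> and \<open>80 / \<epsilon>\<close>.\<close>
  define \<epsilon> where "\<epsilon> = 1 / (60 * c * \<Lambda>)"
  have c\<Lambda>: "1 \<le> c * \<Lambda>" using mult_mono[OF c \<Lambda>] c by simp
  have \<epsilon>: "0 < \<epsilon>" "\<epsilon> \<le> 1" using c\<Lambda> c \<Lambda> unfolding \<epsilon>_def by (auto simp: divide_le_eq)
  have \<epsilon>_mult: "\<epsilon> * (c * (\<Lambda> * t)) = t / 60" for t
    using c \<Lambda> unfolding \<epsilon>_def by (simp add: field_simps)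
  have s: "0 < s" "120 * (H + c) \<le> s" using far c H(1) unfolding s_def by auto
  obtain z where z: "z 0 = \<gamma> \<alpha>" "z n = \<gamma> \<beta>" "\<And>i. i < n \<Longrightarrow> dist (z i) (z (Suc i)) \<le> c"
      "\<And>i. i \<le> n \<Longrightarrow> z i \<in> A"
    using path unfolding coarse_path_def by blast
  define p where "p i = (SOME u. foot (z i) u)" for i
  have p: "foot (z i) (p i)" for i unfolding p_def by (rule someI_ex[OF foot_ex])
  note p_in = foot_in[OF p]
  define ht where "ht i = dist (z i) (\<gamma> (p i))" for i
  have p_end: "p i = w" if "z i = \<gamma> w" "w \<in> {a..b}" for i w
    using foot_le[OF p that(2), of i] \<gamma>_dist[OF that(2) p_in, of i] that by simp
  have z_dist: "dist (z i) (z j) \<le> c * (real j - real i)" if "i \<le> j" "j \<le> n" for i j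
    using that
  proof (induction j rule: dec_induct)
    case (step j)
    then show ?case
      using z(3)[of j] dist_triangle[of "z i" "z (Suc j)" "z j"] by (simp add: algebra_simps)
  qed simp
  have ht_le: "\<epsilon> * ht i \<le> s / 60" if "i \<le> n" for i
  proof -
    have "ht i \<le> dist (z 0) (z i)"
      using foot_le[OF p \<alpha>, of i] z(1) unfolding ht_def by (simp add: dist_commute)
    also have "\<dots> \<le> c * real i" using z_dist[of 0 i] that by simp
    also have "\<dots> \<le> c * (\<Lambda> * s)" using n that c unfolding s_def by (intro mult_left_mono) auto
    finally have "\<epsilon> * ht i \<le> \<epsilon> * (c * (\<Lambda> * s))" using \<epsilon> by (intro mult_left_mono) auto
    then show ?thesis using \<epsilon>_mult by simp
  qed
  have jump: "\<bar>p i - p j\<bar> \<le> \<epsilon> * ht i"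
    if "i \<le> j" "j \<le> n" "H \<le> ht i" "c * (real j - real i) \<le> ht i / 4" for i j
  proof (rule foot_sublinear[OF p p, of _ i])
    show "dist (z i) (z j) \<le> ht i / 4" using z_dist[of i j] that by simp
    show "0 < ht i" using that H c by simp
    have "4 * M (80 / \<epsilon>) 0 \<le> \<epsilon> * H"
      using H(2) c \<Lambda> unfolding \<epsilon>_def by (simp add: field_simps)
    also have "\<dots> \<le> \<epsilon> * ht i" using that \<epsilon> by simp
    finally show "4 * M (80 / \<epsilon>) 0 \<le> \<epsilon> * ht i" .
  qed (use \<epsilon> ht_def in auto)
  \<comment> \<open>Each stride takes the largest number \<open>m\<close> of steps that
    \<open>foot_sublinear\<close> permits. As \<open>8 * c \<le> H\<close>, rounding down costs at
    most a factor 2, so a stride moves the foot by at most \<open>8 * c * \<epsilon> * m\<close>;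
    the last, incomplete one is charged \<open>s / 60\<close>. Only the starts of strides must be
    high, so \<open>z k\<close> may be low.\<close>
  have drift: "\<bar>p i - p k\<bar> \<le> 8 * c * \<epsilon> * (real k - real i) + s / 60"
    if "i \<le> k" "k \<le> n" "\<And>m. i \<le> m \<Longrightarrow> m < k \<Longrightarrow> H \<le> ht m" for i k
    using that
  proof (induction "k - i" arbitrary: i rule: less_induct)
    case less
    show ?case
    proof (cases "i = k")
      case True
      then show ?thesis using s by simp
    next
      case False
      then have ik: "i < k" using less.prems by simp
      have Hi: "H \<le> ht i" using less.prems(3)[of i] ik by simp
      define m where "m = nat \<lfloor>ht i / (4 * c)\<rfloor>"
      have big: "2 \<le> ht i / (4 * c)" using Hi H c by (simp add: le_divide_eq)
      then have m: "real m \<le> ht i / (4 * c)" "ht i / (4 * c) < real m + 1" "0 < m"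
        unfolding m_def by linarith+
      have cm: "c * real m \<le> ht i / 4" using m(1) c by (simp add: field_simps)
      have "ht i / (4 * c) \<le> 2 * real m" using m big by linarith
      then have cm': "ht i \<le> 8 * c * real m" using c by (simp add: field_simps)
      show ?thesis
      proof (cases "k \<le> i + m")
        case True
        have "c * (real k - real i) \<le> c * real m" using True c by (intro mult_left_mono) auto
        then have "\<bar>p i - p k\<bar> \<le> s / 60"
          using jump[of i k] ht_le[of i] cm Hi ik less.prems by force
        moreover have "0 \<le> 8 * c * \<epsilon> * (real k - real i)" using c \<epsilon> ik by simp
        ultimately show ?thesis by linarith
      next
        case False
        have "\<bar>p i - p (i + m)\<bar> \<le> \<epsilon> * ht i" using False less.prems Hi cm by (intro jump) auto
        also have "\<dots> \<le> \<epsilon> * (8 * c * real m)" using cm' \<epsilon> by (intro mult_left_mono) auto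
        finally have "\<bar>p i - p (i + m)\<bar> \<le> 8 * c * \<epsilon> * real m" by (simp add: mult_ac)
        moreover have "\<bar>p (i + m) - p k\<bar> \<le> 8 * c * \<epsilon> * (real k - real (i + m)) + s / 60"
          using False less.prems m ik by (intro less.hyps) auto
        ultimately show ?thesis by (simp add: algebra_simps)
      qed
    qed
  qed
  \<comment> \<open>\<open>k\<close> is the first index with its foot at least two thirds of the way
    along, and \<open>j\<close> the last one before it with its foot at most one third along;
    strictly between them all feet lie in the middle third.\<close>
  define k where "k = (LEAST k. \<alpha> + 2 * s / 3 \<le> p k)"
  have pn: "\<alpha> + 2 * s / 3 \<le> p n" using p_end[OF z(2) \<beta>] s(1) unfolding s_def by (simp add: field_simps)
  have k: "\<alpha> + 2 * s / 3 \<le> p k" unfolding k_def using pn by (rule LeastI)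
  have kn: "k \<le> n" unfolding k_def using pn by (rule Least_le)
  have k_least: "p m < \<alpha> + 2 * s / 3" if "m < k" for m
    using not_less_Least[of m "\<lambda>k. \<alpha> + 2 * s / 3 \<le> p k"] that unfolding k_def by (simp only: not_le)
  have p0: "p 0 = \<alpha>" using p_end[OF z(1) \<alpha>] .
  define S where "S = {i. i < k \<and> p i \<le> \<alpha> + s / 3}"
  define j where "j = Max S"
  have "0 < k" using k p0 s by (cases k) auto
  then have "finite S" "S \<noteq> {}" using p0 s unfolding S_def by auto
  note S_max = Max_in[OF this] Max_ge[OF this(1)]
  have j: "j < k" "p j \<le> \<alpha> + s / 3" using S_max(1)[folded j_def] unfolding S_def by simp_all
  have j_max: "\<alpha> + s / 3 < p m" if "j < m" "m < k" for m
  proof (rule ccontr)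
    assume "\<not> \<alpha> + s / 3 < p m"
    then have "m \<in> S" using that unfolding S_def by simp
    then show False using S_max(2) that(1) unfolding j_def by fastforce
  qed
  have "H \<le> ht m" if m: "Suc j \<le> m" "m < k" for m
  proof -
    have "\<alpha> + s / 3 < p m" "p m < \<alpha> + 2 * s / 3" using j_max[of m] k_least[of m] m by auto
    then have "s / 3 < p m - \<alpha>" "s / 3 < \<beta> - p m" by (simp_all add: s_def field_simps)
    moreover from this have "\<bar>p m - \<alpha>\<bar> = p m - \<alpha>" "\<bar>p m - \<beta>\<bar> = \<beta> - p m"
      using s(1) by linarith+
    moreover have "\<bar>\<alpha> - \<beta>\<bar> = s" using le unfolding s_def by simp
    ultimately have "p m \<in> middle \<alpha> \<beta>" unfolding middle_def by (simp add: s_def)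
    then show ?thesis using avoid[OF z(4), of m "p m"] m kn unfolding ht_def by simp
  qed
  then have "\<bar>p (Suc j) - p k\<bar> \<le> 8 * c * \<epsilon> * (real k - real (Suc j)) + s / 60"
    using j kn by (intro drift) auto
  moreover have "8 * c * \<epsilon> * (real k - real (Suc j)) \<le> 8 * c * \<epsilon> * (\<Lambda> * s)"
    using c \<epsilon> kn n unfolding s_def by (intro mult_left_mono) auto
  moreover have "8 * c * \<epsilon> * (\<Lambda> * s) = 8 * (s / 60)" using \<epsilon>_mult[of s] by (simp add: mult_ac)
  \<comment> \<open>\<open>avoid\<close> need not apply to \<open>z j\<close>. If \<open>z j\<close>
    is low, the two feet are at most \<open>2 * H + 2 * c\<close> apart, which \<open>far\<close>
    absorbs.\<close>
  moreover have "\<bar>p j - p (Suc j)\<bar> \<le> s / 60"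
  proof (cases "H \<le> ht j")
    case True
    then show ?thesis using jump[of j "Suc j"] ht_le[of j] j kn H c by auto
  next
    case False
    have z1: "dist (z j) (z (Suc j)) \<le> c" using z(3) j kn by simp
    have "ht (Suc j) \<le> dist (z (Suc j)) (\<gamma> (p j))"
      using foot_le[OF p p_in] unfolding ht_def by blast
    then have "dist (\<gamma> (p j)) (\<gamma> (p (Suc j))) \<le> 2 * H + 2 * c"
      using z1 False dist_triangle[of "z (Suc j)" "\<gamma> (p j)" "z j"]
        dist_triangle[of "\<gamma> (p j)" "\<gamma> (p (Suc j))" "z (Suc j)"]
      unfolding ht_def by (simp add: dist_commute)
    then show ?thesis using \<gamma>_dist[OF p_in p_in, of j "Suc j"] s by simp
  qed
  ultimately show False using k j(2) s(1) by linarith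
qed

lemma middle_recurrence:
  assumes c: "1 \<le> c" and \<Lambda>: "1 \<le> \<Lambda>"
    and H: "8 * c \<le> H" "240 * c * \<Lambda> * M (4800 * c * \<Lambda>) 0 \<le> H"
    and path: "coarse_path c A n (\<gamma> \<alpha>) (\<gamma> \<beta>)" and \<alpha>: "\<alpha> \<in> {a..b}" and \<beta>: "\<beta> \<in> {a..b}"
    and n: "real n \<le> \<Lambda> * \<bar>\<alpha> - \<beta>\<bar>" and far: "120 * (H + c) \<le> \<bar>\<alpha> - \<beta>\<bar>"
  shows "\<exists>y\<in>A. \<exists>u\<in>middle \<alpha> \<beta>. dist y (\<gamma> u) \<le> H"
proof (cases "\<alpha> \<le> \<beta>")
  case True
  then show ?thesis using assms by (intro middle_recurrence_less[of c \<Lambda>]) auto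
next
  case False
  then show ?thesis
    using assms coarse_path_rev[OF path] unfolding middle_commute[of \<alpha>]
    by (intro middle_recurrence_less[of c \<Lambda>]) auto
qed

section \<open>Combing lines come close to the middle third\<close>

text \<open>From the foot of \<open>x\<close> go towards \<open>x\<close> up to height \<open>H + 1\<close>, follow the fan of combing lines
  issuing from \<open>x\<close> at constant distance from \<open>x\<close>, then go along the combing line to \<open>z\<close> and down
  to the foot of \<open>z\<close>. The fan stays higher than \<open>H\<close>, so only the combing line can meet the middle.\<close>

lemma comb_recurrence:
  assumes x: "foot x u0" and z: "foot z v" and K: "0 \<le> K" "dist z (\<gamma> v) \<le> K * \<bar>u0 - v\<bar>"
    and c: "c = 2 * \<kappa> + 1" and \<Lambda>: "\<Lambda> = 3 * K + 8"
    and H: "8 * c \<le> H" "240 * c * \<Lambda> * M (4800 * c * \<Lambda>) 0 \<le> H"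
    and far: "120 * (H + c) \<le> \<bar>u0 - v\<bar>"
  shows "\<exists>m\<in>range (q x z). \<exists>u\<in>middle u0 v. dist m (\<gamma> u) \<le> H"
proof -
  define s where "s = \<bar>u0 - v\<bar>"
  define R where "R = H + 1"
  define D where "D = dist x (\<gamma> u0)"
  \<comment> \<open>If \<open>D < R\<close> then \<open>T = 0\<close> and the fan collapses to the
    point \<open>x\<close>.\<close>
  define T where "T = max 0 (D - R)"
  define d where "d = dist (\<gamma> u0) z"
  define T' where "T' = max T (dist x z)"
  define e where "e = dist z (\<gamma> v)"
  have c1: "1 \<le> c" using c \<kappa>_nonneg by simp
  have nonneg: "0 \<le> D" "0 \<le> d" "0 \<le> e" unfolding D_def d_def e_def by auto
  have H0: "8 \<le> H" using H(1) c1 by simp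
  have T: "0 \<le> T" "T \<le> D" "D - T \<le> R" "T \<le> T'" "0 \<le> D - T" "0 \<le> T' - T"
    using nonneg H0 unfolding T_def T'_def R_def by auto
  note in_ab = foot_in[OF x] foot_in[OF z]
  have "coarse_path c (q x (\<gamma> u0) ` {T..D}) (nat \<lceil>D - T\<rceil>) (q x (\<gamma> u0) T) (q x (\<gamma> u0) D)"
    using T by (intro coarse_path_sample) (auto simp: c intro: comb_unit_step)
  then have leg1: "coarse_path c (q x (\<gamma> u0) ` {T..D}) (nat \<lceil>D - T\<rceil>) (\<gamma> u0) (q x (\<gamma> u0) T)"
    using coarse_path_rev comb_end[of x "\<gamma> u0" D] unfolding D_def by force
  have "coarse_path c ((\<lambda>t. q x (q (\<gamma> u0) z t) T) ` {0..d}) (nat \<lceil>d - 0\<rceil>)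
      (q x (q (\<gamma> u0) z 0) T) (q x (q (\<gamma> u0) z d) T)"
    using nonneg comb_fan_unit_step[of _ _ x "\<gamma> u0" z T]
    by (intro coarse_path_sample) (auto simp: c intro: add_increasing2)
  then have leg2: "coarse_path c ((\<lambda>t. q x (q (\<gamma> u0) z t) T) ` {0..d}) (nat \<lceil>d\<rceil>)
      (q x (\<gamma> u0) T) (q x z T)"
    by (simp add: comb_end d_def)
  have "coarse_path c (q x z ` {T..T'}) (nat \<lceil>T' - T\<rceil>) (q x z T) (q x z T')"
    using T by (intro coarse_path_sample) (auto simp: c intro: comb_unit_step)
  then have leg3: "coarse_path c (q x z ` {T..T'}) (nat \<lceil>T' - T\<rceil>) (q x z T) z"
    by (simp add: comb_end T'_def)
  have "coarse_path c (q z (\<gamma> v) ` {0..e}) (nat \<lceil>e - 0\<rceil>) (q z (\<gamma> v) 0) (q z (\<gamma> v) e)"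
    using nonneg by (intro coarse_path_sample) (auto simp: c intro: comb_unit_step)
  then have leg4: "coarse_path c (q z (\<gamma> v) ` {0..e}) (nat \<lceil>e\<rceil>) z (\<gamma> v)"
    by (simp add: comb_end e_def)
  note path = coarse_path_append[OF coarse_path_append[OF coarse_path_append[OF leg1 leg2] leg3] leg4]
  \<comment> \<open>The count is independent of \<open>D\<close>: the first leg has length at most
    \<open>R\<close>, the third at most \<open>R + d\<close>. The sum
    \<open>2 * R + 2 * d + e + 4\<close> with \<open>d \<le> e + s\<close>,
    \<open>e \<le> K * s\<close> and \<open>far\<close> gives
    \<open>\<Lambda> = 3 * K + 8\<close>.\<close>
  have "real (nat \<lceil>D - T\<rceil> + nat \<lceil>d\<rceil> + nat \<lceil>T' - T\<rceil> + nat \<lceil>e\<rceil>)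
      \<le> (D - T + 1) + (d + 1) + (T' - T + 1) + (e + 1)"
    using nonneg T by linarith
  moreover have "d \<le> e + s"
    using dist_triangle[of "\<gamma> u0" z "\<gamma> v"] \<gamma>_dist[OF in_ab]
    unfolding d_def e_def s_def by (simp add: dist_commute)
  moreover have "T' - T \<le> R + d"
    using dist_triangle[of x z "\<gamma> u0"] T nonneg H0 unfolding T'_def D_def d_def R_def max_def by auto
  moreover have "e \<le> K * s" using K unfolding e_def s_def by simp
  moreover have "2 * H + 6 \<le> 6 * s" using far H0 c1 unfolding s_def by simp
  ultimately have "real (nat \<lceil>D - T\<rceil> + nat \<lceil>d\<rceil> + nat \<lceil>T' - T\<rceil> + nat \<lceil>e\<rceil>) \<le> 3 * (K * s) + 8 * s"
    using T(3) unfolding R_def by linarith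
  then have n: "real (nat \<lceil>D - T\<rceil> + nat \<lceil>d\<rceil> + nat \<lceil>T' - T\<rceil> + nat \<lceil>e\<rceil>) \<le> \<Lambda> * \<bar>u0 - v\<bar>"
    unfolding \<Lambda> s_def by (simp add: algebra_simps)
  have "1 \<le> \<Lambda>" using K \<Lambda> by simp
  from middle_recurrence[OF c1 this H path in_ab n far]
  obtain y u where y: "y \<in> q x (\<gamma> u0) ` {T..D} \<union> (\<lambda>t. q x (q (\<gamma> u0) z t) T) ` {0..d} \<union>
      q x z ` {T..T'} \<union> q z (\<gamma> v) ` {0..e}"
    and u: "u \<in> middle u0 v" and yu: "dist y (\<gamma> u) \<le> H" by blast
  have u_in: "u \<in> {a..b}" using middle_in in_ab u by blast
  \<comment> \<open>Excludes the first and last legs: a point with foot \<open>w\<close> this close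
    to \<open>\<gamma> u\<close> has \<open>w\<close> within \<open>2 * H\<close> of
    \<open>u\<close>, but the middle third keeps distance \<open>40 * H\<close> from
    \<open>u0\<close> and \<open>v\<close>.\<close>
  have no_foot: False if "foot y w" "w = u0 \<or> w = v" for w
  proof -
    have "w \<in> {a..b}" using that in_ab by auto
    then have "\<bar>u - w\<bar> \<le> 2 * H"
      using foot_le[OF that(1) u_in] yu \<gamma>_dist[of u w] u_in dist_triangle[of "\<gamma> u" "\<gamma> w" y]
      by (auto simp: dist_commute)
    moreover have "40 * H \<le> \<bar>u - w\<bar>" using that(2) middleD(1,2)[OF u] far c1 by auto
    ultimately show False using H0 by linarith
  qed
  have "y \<in> range (q x z)"
    using y
  proof (elim UnE)
    assume "y \<in> q x (\<gamma> u0) ` {T..D}"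
    then have "foot y u0"
      using comb_between[of x "\<gamma> u0"] by (intro foot_between[OF x]) (auto simp: dist_commute add.commute)
    then show ?thesis using no_foot by blast
  next
    assume "y \<in> (\<lambda>t. q x (q (\<gamma> u0) z t) T) ` {0..d}"
    then obtain t where t: "y = q x (q (\<gamma> u0) z t) T" by blast
    show ?thesis
    proof (cases "D < R")
      case True
      then have "y = q x z 0" using t unfolding T_def by simp
      then show ?thesis by blast
    next
      case False
      \<comment> \<open>Such a \<open>y\<close> would put \<open>\<gamma> u\<close> within
        \<open>D - R + H = D - 1\<close> of \<open>x\<close>, closer than the foot.\<close>
      then have "dist x y \<le> D - R" unfolding t T_def comb_dist_start by auto
      then have "dist x (\<gamma> u) < D"
        using yu dist_triangle[of x "\<gamma> u" y] unfolding R_def by linarith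
      then show ?thesis using foot_le[OF x u_in] unfolding D_def by simp
    qed
  next
    assume "y \<in> q x z ` {T..T'}"
    then show ?thesis by blast
  next
    assume "y \<in> q z (\<gamma> v) ` {0..e}"
    then have "foot y v"
      using comb_between[of z "\<gamma> v"] by (intro foot_between[OF z]) (auto simp: dist_commute add.commute)
    then show ?thesis using no_foot by blast
  qed
  then show ?thesis using u yu by blast
qed

section \<open>Contraction relative to the centre of a ball\<close>

lemma foot_contracting:
  assumes x: "foot x u0" and y: "foot y v" and xy: "dist x y \<le> dist x (\<gamma> u0)"
    and c: "c = 2 * \<kappa> + 1"
    and H: "8 * c \<le> H" "240 * c * 68 * M (4800 * c * 68) 0 \<le> H"
  shows "\<bar>u0 - v\<bar> \<le> 1200 * (H + c)"
proof (rule ccontr)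
  assume contra: "\<not> \<bar>u0 - v\<bar> \<le> 1200 * (H + c)"
  define s where "s = \<bar>u0 - v\<bar>"
  define D where "D = dist x (\<gamma> u0)"
  define E where "E = dist y (\<gamma> v)"
  have s: "1200 * H + 1200 * c < s" using contra unfolding s_def by simp
  have H0: "8 \<le> H" "1 \<le> c" "0 \<le> D" "2 * \<kappa> \<le> s" using H(1) c \<kappa>_nonneg s unfolding D_def by auto
  \<comment> \<open>\<open>K = 20\<close> gives \<open>\<Lambda> = 3 * 20 + 8 = 68\<close>.\<close>
  note recur = comb_recurrence[where K = 20 and c = c and \<Lambda> = 68 and H = H, OF _ _ _ _ c _ H, simplified]
  note in_ab = foot_in[OF x] foot_in[OF y]
  have range_between: "dist x' m + dist m z = dist x' z" if "m \<in> range (q x' z)" for x' m z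
    using that comb_between by auto
  \<comment> \<open>Since \<open>\<gamma> u\<close> has distance at least \<open>D\<close> from
    \<open>x\<close> and lies within \<open>H\<close> of the combing line, it is within
    \<open>2 * H\<close> of the endpoint \<open>z\<close>. So the foot of \<open>z\<close> is within
    \<open>4 * H\<close> of \<open>u\<close>, too close for a point of the middle third.\<close>
  have near: "\<bar>u0 - w\<bar> < 120 * (H + c)"
    if z: "foot z w" "dist z (\<gamma> w) \<le> 20 * \<bar>u0 - w\<bar>" "dist x z \<le> D" for z w
  proof (rule ccontr)
    assume contra: "\<not> \<bar>u0 - w\<bar> < 120 * (H + c)"
    then obtain m u where m: "m \<in> range (q x z)" and u: "u \<in> middle u0 w" and mu: "dist m (\<gamma> u) \<le> H"
      using recur[OF x z(1,2)] by (auto simp: not_less)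
    have w_in: "w \<in> {a..b}" using foot_in z by auto
    have u_in: "u \<in> {a..b}" using middle_in in_ab(1) w_in u by blast
    have "dist (\<gamma> u) z \<le> 2 * H"
      using range_between[OF m] z(3) mu foot_le[OF x u_in] dist_triangle[of x "\<gamma> u" m]
        dist_triangle[of "\<gamma> u" z m] unfolding D_def by (simp add: dist_commute)
    moreover have "\<bar>u - w\<bar> \<le> 2 * dist (\<gamma> u) z"
      using \<gamma>_dist[OF u_in w_in] foot_le[OF z(1) u_in] dist_triangle[of "\<gamma> u" "\<gamma> w" z]
      by (simp add: dist_commute)
    moreover have "40 * H + 40 * c \<le> \<bar>u - w\<bar>" using order_trans[OF _ middleD(2)[OF u]] contra by simp
    ultimately show False using H0 by linarith
  qed
  define Y where "Y t = q (\<gamma> v) y t" for t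
  define g where "g t = q x (Y t) D" for t
  define f where "f t = infdist (g t) (\<gamma> ` {a..b})" for t
  have Y_foot: "foot (Y t) v" for t
    using foot_between[OF y] comb_between unfolding Y_def by blast
  have f_foot: "f t = dist (g t) (\<gamma> w)" if "foot (g t) w" for t w
    using foot_infdist[OF that] unfolding f_def .
  have f_step: "f t' \<le> f t + 2 * \<kappa>" if "\<bar>t - t'\<bar> \<le> 1" for t t'
    using infdist_triangle[of "g t'" "\<gamma> ` {a..b}" "g t"] comb_fan_unit_step[OF that, of x "\<gamma> v" y D]
    unfolding f_def g_def Y_def by (simp add: dist_commute)
  \<comment> \<open>The combing line to \<open>\<gamma> v\<close> passes within \<open>H\<close> of
    \<open>\<gamma> u\<close> at a time differing from \<open>D\<close> by at most
    \<open>2 * s / 3 + H\<close>, so the height at time \<open>D\<close> is at most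
    \<open>2 * s / 3 + 2 * H\<close>.\<close>
  have f_start: "f 0 < s"
  proof -
    obtain m u where m: "m \<in> range (q x (\<gamma> v))" and u: "u \<in> middle u0 v" and mu: "dist m (\<gamma> u) \<le> H"
      using recur[OF x foot_on[OF in_ab(2)]] s H0 unfolding s_def by auto
    have u_in: "u \<in> {a..b}" using middle_in in_ab u by blast
    obtain \<tau> where \<tau>: "m = q x (\<gamma> v) \<tau>" using m by blast
    have "D \<le> dist x (\<gamma> v)" using foot_le[OF x in_ab(2)] unfolding D_def .
    then have "dist (g 0) m \<le> \<bar>D - dist x m\<bar>"
      using H0(3) unfolding g_def Y_def \<tau> comb_0 comb_dist comb_dist_start by (auto simp: max_def min_def)
    moreover have "dist x m \<le> D + \<bar>u0 - u\<bar> + H" "D \<le> dist x m + H"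
      using mu foot_le[OF x u_in] dist_triangle[of x "\<gamma> u" m] dist_triangle[of x m "\<gamma> u"]
        dist_triangle[of x "\<gamma> u" "\<gamma> u0"] \<gamma>_dist[OF in_ab(1) u_in] unfolding D_def
      by (auto simp: dist_commute)
    moreover have "\<bar>u0 - u\<bar> \<le> 2 * s / 3" using middleD(3)[OF u] unfolding s_def by linarith
    moreover have "f 0 \<le> dist (g 0) (\<gamma> u)" unfolding f_def using u_in by (intro infdist_le) auto
    ultimately show ?thesis using mu s H0 dist_triangle[of "g 0" "\<gamma> u" m] by linarith
  qed
  have "s < E"
  proof (rule ccontr)
    assume "\<not> ?thesis"
    then have "dist y (\<gamma> v) \<le> 20 * s" using s H0 unfolding E_def by linarith
    then have "\<bar>u0 - v\<bar> < 120 * (H + c)"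
      using xy unfolding s_def by (intro near[OF y]) (simp_all add: D_def)
    then show False using s H0 unfolding s_def by simp
  qed
  moreover have "g E = y"
  proof -
    have "Y E = y" unfolding Y_def E_def by (rule comb_end) (simp add: dist_commute)
    then show ?thesis unfolding g_def using xy by (simp add: comb_end D_def)
  qed
  ultimately have f_end: "s < f E" using foot_infdist[OF y] unfolding f_def E_def by simp
  \<comment> \<open>A discrete intermediate value argument: \<open>f\<close> may jump by
    \<open>2 * \<kappa>\<close> per unit of time, so at the first sample with
    \<open>s \<le> f\<close> it is at most \<open>s + 2 * \<kappa> \<le> 2 * s\<close>.\<close>
  define t where "t i = min (real i) E" for i
  define i where "i = (LEAST i. s \<le> f (t i))"
  have "t (nat \<lceil>E\<rceil>) = E" unfolding t_def by (intro min_absorb2 real_nat_ceiling_ge)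
  then have "s \<le> f (t (nat \<lceil>E\<rceil>))" using f_end by simp
  then have i: "s \<le> f (t i)" unfolding i_def by (rule LeastI)
  have i_least: "f (t m) < s" if "m < i" for m
    using not_less_Least[of m "\<lambda>i. s \<le> f (t i)"] that unfolding i_def by (simp add: not_le)
  have "t 0 = 0" unfolding t_def E_def by simp
  then have "0 < i" using i f_start by (cases i) auto
  then have "f (t i) \<le> f (t (i - 1)) + 2 * \<kappa>" by (intro f_step) (auto simp: t_def min_def)
  then have f_up: "f (t i) \<le> 2 * s" using i_least[of "i - 1"] \<open>0 < i\<close> H0 by auto
  define y' where "y' = Y (t i)"
  define z where "z = g (t i)"
  have z_def': "z = q x y' D" unfolding z_def g_def y'_def ..
  have y': "foot y' v" unfolding y'_def by (rule Y_foot)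
  show False
  proof (cases "dist x y' \<le> D")
    case True
    then have "z = y'" unfolding z_def' by (rule comb_end)
    then have "\<bar>u0 - v\<bar> < 120 * (H + c)"
      using f_foot[of "t i" v] f_up y' True s H0 unfolding z_def[symmetric] s_def
      by (intro near[of y']) auto
    then show False using s H0 unfolding s_def by simp
  next
    case False
    then have xz: "dist x z = D" using H0 unfolding z_def' comb_dist_start by simp
    obtain w where w: "foot z w" using foot_ex by blast
    have w_in: "w \<in> {a..b}" using foot_in w by auto
    have ht: "s \<le> dist z (\<gamma> w)" "dist z (\<gamma> w) \<le> 2 * s"
      using f_foot[of "t i" w] w i f_up unfolding z_def[symmetric] by auto
    \<comment> \<open>This fixes two constants: \<open>2 * s \<le> 20 * (s / 10)\<close> makes
      \<open>near\<close> applicable, and \<open>s > 1200 * (H + c)\<close> puts its bound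
      \<open>120 * (H + c)\<close> below \<open>s / 10\<close>.\<close>
    have w_near: "\<bar>u0 - w\<bar> < s / 10"
    proof (rule ccontr)
      assume "\<not> ?thesis"
      with near[OF w] ht xz s H0 show False by auto
    qed
    moreover have "s \<le> \<bar>v - w\<bar> + \<bar>u0 - w\<bar>" "\<bar>v - w\<bar> \<le> s + \<bar>u0 - w\<bar>"
      unfolding s_def by linarith+
    ultimately have vw: "9 * s / 10 < \<bar>v - w\<bar>" "\<bar>v - w\<bar> < 11 * s / 10" by linarith+
    then obtain m u where m: "m \<in> range (q y' z)" and u: "u \<in> middle v w" and mu: "dist m (\<gamma> u) \<le> H"
      using recur[OF y' w] ht s H0 by auto
    have u_in: "u \<in> {a..b}" using middle_in in_ab(2) w_in u by blast
    have "dist y' (\<gamma> u) + dist (\<gamma> u) z \<le> dist y' z + 2 * H"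
      using range_between[OF m] mu dist_triangle[of y' "\<gamma> u" m] dist_triangle[of "\<gamma> u" z m]
      by (simp add: dist_commute)
    moreover have "dist x y' = D + dist y' z"
      using comb_between[of x y' D] xz unfolding z_def' by (simp add: dist_commute)
    moreover have "dist x y' \<le> dist x (\<gamma> u) + dist y' (\<gamma> u)"
      using dist_triangle[of x y' "\<gamma> u"] by (simp add: dist_commute)
    moreover have "dist x (\<gamma> u) \<le> D + \<bar>u0 - u\<bar>"
      using dist_triangle[of x "\<gamma> u" "\<gamma> u0"] \<gamma>_dist[OF in_ab(1) u_in] unfolding D_def by simp
    moreover have "s \<le> dist (\<gamma> u) z" using ht foot_le[OF w u_in] by (simp add: dist_commute)
    moreover have "\<bar>u0 - u\<bar> \<le> \<bar>u0 - w\<bar> + \<bar>u - w\<bar>" by linarith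
    \<comment> \<open>Two thirds of \<open>11 * s / 10\<close> is \<open>11 * s / 15\<close>; the
      total \<open>5 * s / 6\<close> falls short of the required \<open>s - 2 * H\<close>.\<close>
    moreover have "\<bar>u0 - w\<bar> + \<bar>u - w\<bar> \<le> s / 10 + 11 * s / 15"
      using middleD(4)[OF u] vw w_near by argo
    ultimately show False using s H0 by linarith
  qed
qed

end

section \<open>From compact segments to arbitrary geodesics\<close>

theorem corollary1p13:
  fixes q :: "'a::metric_space \<Rightarrow> 'a \<Rightarrow> real \<Rightarrow> 'a"
  assumes "geodesic_space TYPE('a)"
    and "bounded_geodesic_combing q"
  shows "morse_dichotomous TYPE('a)"
  unfolding morse_dichotomous_def
proof (intro allI impI)
  fix M :: "real \<Rightarrow> real \<Rightarrow> real"
  obtain \<kappa> where \<kappa>: "combing q \<kappa>"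
    using assms(2) unfolding bounded_geodesic_combing_def combing_def by blast
  define c where "c = 2 * \<kappa> + 1"
  define H where "H = max (8 * c) (240 * c * 68 * M (4800 * c * 68) 0)"
  \<comment> \<open>Twice the bound of \<open>foot_contracting\<close>, because both closest points
    are compared with the foot of the centre.\<close>
  have "strongly_contracting_on (2400 * (H + c)) I \<gamma>"
    if \<gamma>: "geodesic_on I \<gamma>" "morse_on M I \<gamma>" for I and \<gamma> :: "real \<Rightarrow> 'a"
    unfolding strongly_contracting_on_def
  proof (intro allI impI)
    fix x r
    assume disj: "ball x r \<inter> \<gamma> ` I = {}"
    define P where "P = (\<Union>y\<in>ball x r. closest_points (\<gamma> ` I) y)"
    have P: "dist p1 p2 \<le> 2400 * (H + c)" if "p1 \<in> P" "p2 \<in> P" for p1 p2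
    proof -
      obtain y1 t1 where 1: "dist x y1 < r" "t1 \<in> I" "p1 = \<gamma> t1"
        "\<And>w. w \<in> I \<Longrightarrow> dist y1 (\<gamma> t1) \<le> dist y1 (\<gamma> w)"
        using \<open>p1 \<in> P\<close> unfolding P_def closest_points_def by auto
      obtain y2 t2 where 2: "dist x y2 < r" "t2 \<in> I" "p2 = \<gamma> t2"
        "\<And>w. w \<in> I \<Longrightarrow> dist y2 (\<gamma> t2) \<le> dist y2 (\<gamma> w)"
        using \<open>p2 \<in> P\<close> unfolding P_def closest_points_def by auto
      \<comment> \<open>On the segment spanned by the two closest points they remain closest, and
        the Morse property is inherited with the same gauge.\<close>
      define a where "a = min t1 t2"
      define b where "b = max t1 t2"
      have "is_interval I" using \<gamma>(1) unfolding geodesic_on_def by blast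
      moreover have "a \<in> I" "b \<in> I" using 1(2) 2(2) unfolding a_def b_def by (simp_all add: min_def max_def)
      ultimately have J: "{a..b} \<subseteq> I"
        unfolding is_interval_1 subset_iff atLeastAtMost_iff by blast
      interpret combing q \<kappa> by (rule \<kappa>)
      interpret morse_segment q \<kappa> \<gamma> a b M
      proof
        show "a \<le> b" unfolding a_def b_def by simp
        show "geodesic_on {a..b} \<gamma>"
          using \<gamma>(1) J unfolding geodesic_on_def by (auto simp: is_interval_cc)
        show "morse_on M {a..b} \<gamma>"
          using \<gamma>(2) J unfolding morse_on_def by (meson subsetD)
      qed
      obtain u0 where u0: "foot x u0" using foot_ex by blast
      have "r \<le> dist x (\<gamma> u0)" using disj foot_in[OF u0] J by force
      then have close: "dist x y1 \<le> dist x (\<gamma> u0)" "dist x y2 \<le> dist x (\<gamma> u0)"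
        using 1(1) 2(1) by linarith+
      have "t1 \<in> {a..b}" "t2 \<in> {a..b}" unfolding a_def b_def by simp_all
      then have feet: "foot y1 t1" "foot y2 t2"
        unfolding foot_def using 1(4) 2(4) J by blast+
      have H: "8 * c \<le> H" "240 * c * 68 * M (4800 * c * 68) 0 \<le> H" unfolding H_def by simp_all
      have "\<bar>u0 - t1\<bar> \<le> 1200 * (H + c)"
        by (rule foot_contracting[OF u0 feet(1) close(1) c_def H])
      moreover have "\<bar>u0 - t2\<bar> \<le> 1200 * (H + c)"
        by (rule foot_contracting[OF u0 feet(2) close(2) c_def H])
      moreover have "dist p1 p2 = \<bar>t1 - t2\<bar>"
        using \<gamma>(1) 1 2 unfolding geodesic_on_def by auto
      ultimately show ?thesis by linarith
    qed
    \<comment> \<open>Covers an empty \<open>P\<close>, whose diameter is 0.\<close>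
    have "0 \<le> 2400 * (H + c)"
      using \<kappa> unfolding combing_def H_def c_def by auto
    then have "diameter P \<le> 2400 * (H + c)"
      using P by (auto simp: diameter_def intro!: cSUP_least)
    moreover have "bounded P"
      using P unfolding bounded_two_points by blast
    ultimately show "let P = (\<Union>y\<in>ball x r. closest_points (\<gamma> ` I) y)
        in bounded P \<and> diameter P \<le> 2400 * (H + c)"
      unfolding P_def by simp
  qed
  then show "\<exists>C. \<forall>I (\<gamma> :: real \<Rightarrow> 'a). geodesic_on I \<gamma> \<and> morse_on M I \<gamma>
      \<longrightarrow> strongly_contracting_on C I \<gamma>" by blast
qed

end
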